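(* Let $B$ be a non-trivial Boolean algebra and let $M\subseteq B$ be a stack whose infimum in $B$ is $0$. If $M$ is not a grill, then there are ultracontacts $\mathscr K_1,\mathscr K_2$ on $B$ such that $M\in\mathscr K_1\cap\mathscr K_2$ but $M\notin\mathscr K_1\wedge\mathscr K_2$, where $\wedge$ is the meet in the lattice $\mathrm{UC}(B)$. Consequently, the collection of all ultracontacts on $B$ that contain $M$ is not closed under infima in $\mathrm{UC}(B)$.
   Context: Let $B$ be a non-trivial Boolean algebra with order $\le$ and join $+$. A stack of $B$ is an upward closed subset of $B$. A grill of $B$ is a non-empty set $G\subseteq B$ such that $0\notin G$; if $a\in G$ and $a\le b$ then $b\in G$; and if $a+b\in G$ then $a\in G$ or $b\in G$. For $F,G\subseteq B$ put $F+G=\{f+g: f\in F,\ g\in G\}$, and write $F\preceq G$ iff for every $g\in G$ there is $f\in F$ with $f\le g$. An ultracontact on $B$ is a family $\mathscr K\subseteq 2^B$ such that for all $F,G\subseteq B$: (K0) $\emptyset\notin\mathscr K$; (K1) if $0\in F$ then $F\notin\mathscr K$; (K2) if $x\neq 0$ then $\{x\}\in\mathscr K$; (K3) if $F\preceq G$, $G\neq\emptyset$ and $F\in\mathscr K$, then $G\in\mathscr K$; (K4) if $F+G\in\mathscr K$ then $F\in\mathscr K$ or $G\in\mathscr K$. $\mathrm{UC}(B)$ is the complete lattice of ultracontacts on $B$ ordered by inclusion.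
   Formalization: The stack M is additionally assumed not to contain 0, that is, M ≠ B; for M = B the claim fails, since B is a stack with infimum 0 that is not a grill, yet by (K1) no ultracontact contains it. *)

theory Defs
  imports "HOL-Library.Lub_Glb" "HOL-Algebra.Complete_Lattice"
begin

text \<open>The Boolean algebra \<open>B\<close> is a type of class \<open>boolean_algebra\<close>; its zero and join are
  \<^term>\<open>bot\<close> and \<^term>\<open>sup\<close>.\<close>

definition stack :: "'a::boolean_algebra set \<Rightarrow> bool"
  where "stack S \<longleftrightarrow> (\<forall>a\<in>S. \<forall>b. a \<le> b \<longrightarrow> b \<in> S)"

definition grill :: "'a::boolean_algebra set \<Rightarrow> bool"
  where "grill G \<longleftrightarrow> G \<noteq> {} \<and> bot \<notin> G
     \<and> (\<forall>a b. a \<in> G \<and> a \<le> b \<longrightarrow> b \<in> G)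
     \<and> (\<forall>a b. sup a b \<in> G \<longrightarrow> a \<in> G \<or> b \<in> G)"

definition set_join :: "'a::boolean_algebra set \<Rightarrow> 'a set \<Rightarrow> 'a set"
  where "set_join F G = {sup f g |f g. f \<in> F \<and> g \<in> G}"

definition refines :: "'a::boolean_algebra set \<Rightarrow> 'a set \<Rightarrow> bool"  (infix \<open>\<preceq>\<close> 50)
  where "F \<preceq> G \<longleftrightarrow> (\<forall>g\<in>G. \<exists>f\<in>F. f \<le> g)"

definition ultracontact :: "'a::boolean_algebra set set \<Rightarrow> bool"
  where "ultracontact K \<longleftrightarrow>
     {} \<notin> K
     \<and> (\<forall>F. bot \<in> F \<longrightarrow> F \<notin> K)
     \<and> (\<forall>x. x \<noteq> bot \<longrightarrow> {x} \<in> K)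
     \<and> (\<forall>F G. F \<preceq> G \<and> G \<noteq> {} \<and> F \<in> K \<longrightarrow> G \<in> K)
     \<and> (\<forall>F G. set_join F G \<in> K \<longrightarrow> F \<in> K \<or> G \<in> K)"

definition UC :: "'a::boolean_algebra set set gorder"
  where "UC = \<lparr>carrier = {K. ultracontact K}, eq = (=), le = (\<subseteq>)\<rparr>"

text \<open>Infima of non-empty subfamilies only: the empty infimum is the top element of \<open>L\<close>.\<close>

definition closed_under_infima :: "'b gorder \<Rightarrow> 'b set \<Rightarrow> bool"
  where "closed_under_infima L C \<longleftrightarrow> (\<forall>A. A \<subseteq> C \<and> A \<noteq> {} \<longrightarrow> \<Sqinter>\<^bsub>L\<^esub> A \<in> C)"

text \<open>The library's \<open>\<Sqinter>\<^bsub>L\<^esub>\<close> and \<open>\<sqinter>\<^bsub>L\<^esub>\<close> choose a greatest lower bound, so they are meaningful on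
  \<^term>\<open>UC\<close> only because of the following lemmas.\<close>

lemma ultracontact_top: "ultracontact {F :: 'a::boolean_algebra set. F \<noteq> {} \<and> bot \<notin> F}"
  unfolding ultracontact_def
proof (intro conjI allI impI)
  fix F G :: "'a set"
  assume "F \<preceq> G \<and> G \<noteq> {} \<and> F \<in> {F. F \<noteq> {} \<and> bot \<notin> F}"
  then show "G \<in> {F. F \<noteq> {} \<and> bot \<notin> F}"
    unfolding refines_def by (auto dest!: bspec[of G _ bot] simp: bot_unique)
next
  fix F G :: "'a set"
  assume "set_join F G \<in> {F. F \<noteq> {} \<and> bot \<notin> F}"
  then show "F \<in> {F. F \<noteq> {} \<and> bot \<notin> F} \<or> G \<in> {F. F \<noteq> {} \<and> bot \<notin> F}"
    unfolding set_join_def by force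
qed auto

lemma ultracontact_least:
  "ultracontact {F :: 'a::boolean_algebra set. F \<noteq> {} \<and> (\<exists>x. x \<noteq> bot \<and> (\<forall>f\<in>F. x \<le> f))}"
    (is "ultracontact ?K")
  unfolding ultracontact_def
proof (intro conjI allI impI)
  fix F G :: "'a set"
  assume "F \<preceq> G \<and> G \<noteq> {} \<and> F \<in> ?K"
  then obtain x where *: "F \<preceq> G" "G \<noteq> {}" "x \<noteq> bot" "\<forall>f\<in>F. x \<le> f" by blast
  then have "\<forall>g\<in>G. x \<le> g"
    unfolding refines_def by (meson order_trans)
  with * show "G \<in> ?K" by blast
next
  fix F G :: "'a set"
  assume "set_join F G \<in> ?K"
  then obtain x where ne: "F \<noteq> {}" "G \<noteq> {}" and x: "x \<noteq> bot"
    and le: "\<And>f g. f \<in> F \<Longrightarrow> g \<in> G \<Longrightarrow> x \<le> sup f g"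
    unfolding set_join_def by blast
  show "F \<in> ?K \<or> G \<in> ?K"
  proof (cases "\<forall>f\<in>F. x \<le> f")
    case True
    then show ?thesis using ne x by blast
  next
    case False
    then obtain f where f: "f \<in> F" "\<not> x \<le> f" by blast
    have "inf x (- f) \<noteq> bot"
      using f(2) by (simp add: inf_shunt)
    moreover have "\<forall>g\<in>G. inf x (- f) \<le> g"
      using le[OF f(1)] by (simp add: shunt2)
    ultimately show ?thesis using ne by blast
  qed
next
  fix F :: "'a set"
  assume "bot \<in> F"
  then show "F \<notin> ?K" by (auto dest!: bspec[of F _ bot] simp: bot_unique)
qed auto

lemma ultracontact_least_subset:
  fixes K :: "'a::boolean_algebra set set"
  assumes "ultracontact K"
  shows "{F. F \<noteq> {} \<and> (\<exists>x. x \<noteq> bot \<and> (\<forall>f\<in>F. x \<le> f))} \<subseteq> K"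
proof
  fix F :: "'a set"
  assume "F \<in> {F. F \<noteq> {} \<and> (\<exists>x. x \<noteq> bot \<and> (\<forall>f\<in>F. x \<le> f))}"
  then obtain x where "F \<noteq> {}" "x \<noteq> bot" "{x} \<preceq> F"
    unfolding refines_def by blast
  moreover from this have "{x} \<in> K" using assms unfolding ultracontact_def by simp
  ultimately show "F \<in> K" using assms unfolding ultracontact_def by metis
qed

lemma ultracontact_Union:
  assumes "\<And>K. K \<in> A \<Longrightarrow> ultracontact K" "A \<noteq> {}"
  shows "ultracontact (\<Union>A)"
proof -
  have a: "{} \<notin> K" "bot \<in> F \<Longrightarrow> F \<notin> K" "x \<noteq> bot \<Longrightarrow> {x} \<in> K"
    "F \<preceq> G \<Longrightarrow> G \<noteq> {} \<Longrightarrow> F \<in> K \<Longrightarrow> G \<in> K"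
    "set_join F G \<in> K \<Longrightarrow> F \<in> K \<or> G \<in> K" if "K \<in> A" for K F G x
    using assms(1)[OF that] unfolding ultracontact_def by simp_all
  show ?thesis
    unfolding ultracontact_def
  proof (intro conjI allI impI)
    show "{x} \<in> \<Union>A" if "x \<noteq> bot" for x using a(3)[OF _ that] assms(2) by blast
    show "G \<in> \<Union>A" if "F \<preceq> G \<and> G \<noteq> {} \<and> F \<in> \<Union>A" for F G using a(4) that by blast
    show "F \<in> \<Union>A \<or> G \<in> \<Union>A" if "set_join F G \<in> \<Union>A" for F G using a(5) that by blast
    show "{} \<notin> \<Union>A" using a(1) by blast
    show "F \<notin> \<Union>A" if "bot \<in> F" for F using a(2)[OF _ that] by blast
  qed
qed

lemma complete_lattice_UC: "complete_lattice (UC :: 'a::boolean_algebra set set gorder)"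
proof -
  have po: "partial_order (UC :: 'a set set gorder)"
    unfolding UC_def by unfold_locales simp_all
  show ?thesis
  proof (rule partial_order.complete_lattice_criterion1[OF po])
    have "K \<subseteq> {F. F \<noteq> {} \<and> bot \<notin> F}" if "ultracontact K" for K :: "'a set set"
      using that unfolding ultracontact_def by blast
    then have "greatest UC {F :: 'a set. F \<noteq> {} \<and> bot \<notin> F} (carrier UC)"
      using ultracontact_top by (simp add: greatest_def UC_def)
    then show "\<exists>g :: 'a set set. greatest UC g (carrier UC)" by blast
  next
    fix A :: "'a set set set"
    assume A: "A \<subseteq> carrier UC" "A \<noteq> {}"
    let ?L = "{K. ultracontact K \<and> (\<forall>K'\<in>A. K \<subseteq> K')}"
    have uc: "ultracontact K" if "K \<in> A" for K using A that by (auto simp: UC_def)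
    have "{F. F \<noteq> {} \<and> (\<exists>x. x \<noteq> bot \<and> (\<forall>f\<in>F. x \<le> f))} \<in> ?L"
      using ultracontact_least ultracontact_least_subset[OF uc] by simp
    then have "?L \<noteq> {}" by (metis empty_iff)
    then have "ultracontact (\<Union>?L)"
      by (rule ultracontact_Union[rotated]) simp
    then have "greatest UC (\<Union>?L) (Lower UC A)"
      using A(2) uc by (auto simp: greatest_def Lower_def UC_def)
    then show "\<exists>i. greatest UC i (Lower UC A)" by blast
  qed
qed

end

theory Submission
  imports Defs
begin

text \<open>For a set \<open>S\<close> with infimum \<open>0\<close>, the non-empty sets that do not refine \<open>S\<close> form an
  ultracontact; it is the greatest one avoiding \<open>S\<close>.  Since \<open>M\<close> is not a grill, some
  \<open>a + b \<in> M\<close> has \<open>a, b \<notin> M\<close>.  The greatest ultracontacts avoiding \<open>M \<union> {a}\<close> and \<open>M \<union> {b}\<close>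
  both contain \<open>M\<close>.  No ultracontact below both contains \<open>M\<close>: as
  \<open>(M \<union> {a}) + (M \<union> {b}) \<subseteq> M\<close>, (K3) and (K4) would put \<open>M \<union> {a}\<close> or \<open>M \<union> {b}\<close> in it.\<close>

lemma refines_trans: "F \<preceq> G \<Longrightarrow> G \<preceq> H \<Longrightarrow> F \<preceq> H"
  unfolding refines_def by (meson order_trans)

lemma refines_superset: "G \<subseteq> F \<Longrightarrow> F \<preceq> G"
  unfolding refines_def by blast

lemma set_join_refines:
  assumes "F \<preceq> S" "G \<preceq> S"
  shows "set_join F G \<preceq> S"
  unfolding refines_def
proof
  fix s assume "s \<in> S"
  then obtain f g where "f \<in> F" "f \<le> s" "g \<in> G" "g \<le> s"
    using assms unfolding refines_def by blast
  then show "\<exists>h\<in>set_join F G. h \<le> s"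
    unfolding set_join_def by (intro bexI[of _ "sup f g"]) auto
qed

definition avoiding :: "'a::boolean_algebra set \<Rightarrow> 'a set set"
  where "avoiding S = {F. F \<noteq> {} \<and> \<not> F \<preceq> S}"

text \<open>The infimum hypothesis yields (K2): if \<open>{x}\<close> refines \<open>S\<close>, then
  \<open>x\<close> is a lower bound of \<open>S\<close>, hence \<open>bot\<close>. (K3) is
  transitivity of refinement, and (K4) is the contrapositive of
  \<open>set_join_refines\<close>.\<close>

lemma ultracontact_avoiding:
  fixes S :: "'a::boolean_algebra set"
  assumes "isGlb UNIV S bot"
  shows "ultracontact (avoiding S)"
  unfolding ultracontact_def avoiding_def
proof (intro conjI allI impI)
  fix x :: 'a
  assume "x \<noteq> bot"
  moreover have "x = bot" if "{x} \<preceq> S"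
  proof -
    have "x \<le> bot"
      using isGlb_le_isLb[OF assms, of x] that
      by (auto simp: isLb_def setge_def refines_def)
    then show ?thesis by (simp add: bot_unique)
  qed
  ultimately show "{x} \<in> {F. F \<noteq> {} \<and> \<not> F \<preceq> S}" by blast
next
  fix F :: "'a set"
  assume "bot \<in> F"
  then have "F \<preceq> S" unfolding refines_def using bot_least by blast
  then show "F \<notin> {F. F \<noteq> {} \<and> \<not> F \<preceq> S}" by simp
next
  fix F G :: "'a set"
  assume "F \<preceq> G \<and> G \<noteq> {} \<and> F \<in> {F. F \<noteq> {} \<and> \<not> F \<preceq> S}"
  then show "G \<in> {F. F \<noteq> {} \<and> \<not> F \<preceq> S}" using refines_trans by blast
next
  fix F G :: "'a set"
  assume *: "set_join F G \<in> {F. F \<noteq> {} \<and> \<not> F \<preceq> S}"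
  then have "F \<noteq> {}" "G \<noteq> {}" by (auto simp: set_join_def)
  with * show "F \<in> {F. F \<noteq> {} \<and> \<not> F \<preceq> S} \<or> G \<in> {F. F \<noteq> {} \<and> \<not> F \<preceq> S}"
    using set_join_refines by blast
qed simp

lemma not_in_avoiding: "S \<notin> avoiding S"
  by (simp add: avoiding_def refines_superset)

text \<open>Otherwise some member of \<open>M\<close> would lie below \<open>a\<close>, and upward
  closure would put \<open>a\<close> in \<open>M\<close>.\<close>

lemma stack_in_avoiding_insert:
  assumes "stack M" "M \<noteq> {}" "a \<notin> M"
  shows "M \<in> avoiding (insert a M)"
  using assms unfolding avoiding_def refines_def stack_def by auto

text \<open>Makes \<open>ultracontact_avoiding\<close> applicable to \<open>insert a M\<close> and
  \<open>insert b M\<close>.\<close>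

lemma isGlb_bot_superset:
  fixes S :: "'a::boolean_algebra set"
  assumes "isGlb UNIV S bot" "S \<subseteq> T"
  shows "isGlb UNIV T bot"
  using assms unfolding isGlb_def greatestP_def isLb_def setge_def setle_def by auto

lemma meet_UC:
  fixes K L :: "'a::boolean_algebra set set"
  assumes "ultracontact K" "ultracontact L"
  shows "ultracontact (K \<sqinter>\<^bsub>UC\<^esub> L)" "K \<sqinter>\<^bsub>UC\<^esub> L \<subseteq> K" "K \<sqinter>\<^bsub>UC\<^esub> L \<subseteq> L"
proof -
  interpret complete_lattice "UC :: 'a set set gorder" by (rule complete_lattice_UC)
  have c: "K \<in> carrier UC" "L \<in> carrier UC" using assms by (auto simp: UC_def)
  show "ultracontact (K \<sqinter>\<^bsub>UC\<^esub> L)" using meet_closed[OF c] by (simp add: UC_def)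
  show "K \<sqinter>\<^bsub>UC\<^esub> L \<subseteq> K" using meet_left[OF c] by (simp add: UC_def)
  show "K \<sqinter>\<^bsub>UC\<^esub> L \<subseteq> L" using meet_right[OF c] by (simp add: UC_def)
qed

theorem theorem5p4:
  fixes M :: "'a::boolean_algebra set"
  assumes nontrivial: "(bot :: 'a) \<noteq> top_class.top"
    and "stack M"
    and proper: "bot \<notin> M"
    and "isGlb UNIV M bot"
    and "\<not> grill M"
  shows "(\<exists>K\<^sub>1 K\<^sub>2. ultracontact K\<^sub>1 \<and> ultracontact K\<^sub>2
            \<and> M \<in> K\<^sub>1 \<inter> K\<^sub>2 \<and> M \<notin> K\<^sub>1 \<sqinter>\<^bsub>UC\<^esub> K\<^sub>2)
       \<and> \<not> closed_under_infima UC {K. ultracontact K \<and> M \<in> K}"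
proof -
  \<comment> \<open>Every element is a lower bound of the empty set, so its infimum would be
    top.\<close>
  have "M \<noteq> {}"
  proof
    assume "M = {}"
    then have "(top_class.top :: 'a) \<le> bot"
      using isGlb_le_isLb[OF assms(4), of top_class.top] by (simp add: isLb_def setge_def)
    with nontrivial show False by (simp add: bot_unique)
  qed
  \<comment> \<open>The other three grill conditions hold for \<open>M\<close>, so the one on joins
    fails.\<close>
  with assms obtain a b where ab: "sup a b \<in> M" "a \<notin> M" "b \<notin> M"
    unfolding grill_def stack_def by blast
  define K\<^sub>1 K\<^sub>2 where K: "K\<^sub>1 = avoiding (insert a M)" "K\<^sub>2 = avoiding (insert b M)"
  have uc: "ultracontact K\<^sub>1" "ultracontact K\<^sub>2"
    unfolding K using assms(4) by (blast intro: ultracontact_avoiding isGlb_bot_superset)+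
  have M: "M \<in> K\<^sub>1" "M \<in> K\<^sub>2"
    unfolding K using \<open>stack M\<close> \<open>M \<noteq> {}\<close> ab(2,3) by (simp_all add: stack_in_avoiding_insert)
  have not_meet: "M \<notin> K\<^sub>1 \<sqinter>\<^bsub>UC\<^esub> K\<^sub>2"
  proof
    let ?J = "set_join (insert a M) (insert b M)"
    assume "M \<in> K\<^sub>1 \<sqinter>\<^bsub>UC\<^esub> K\<^sub>2"
    \<comment> \<open>Every join other than \<open>sup a b\<close> has a summand in
      \<open>M\<close>, so upward closure applies.\<close>
    moreover have "?J \<subseteq> M"
      using ab(1) \<open>stack M\<close> unfolding set_join_def stack_def by (auto intro: sup_ge1 sup_ge2)
    then have "M \<preceq> ?J" by (rule refines_superset)
    moreover have "?J \<noteq> {}" unfolding set_join_def by blast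
    ultimately have "?J \<in> K\<^sub>1 \<sqinter>\<^bsub>UC\<^esub> K\<^sub>2"
      using meet_UC(1)[OF uc] unfolding ultracontact_def by metis
    then have "insert a M \<in> K\<^sub>1 \<sqinter>\<^bsub>UC\<^esub> K\<^sub>2 \<or> insert b M \<in> K\<^sub>1 \<sqinter>\<^bsub>UC\<^esub> K\<^sub>2"
      using meet_UC(1)[OF uc] unfolding ultracontact_def by metis
    then have "insert a M \<in> K\<^sub>1 \<or> insert b M \<in> K\<^sub>2"
      using meet_UC(2,3)[OF uc] by blast
    then show False unfolding K using not_in_avoiding by blast
  qed
  have "\<not> closed_under_infima UC {K. ultracontact K \<and> M \<in> K}"
  proof
    assume "closed_under_infima UC {K. ultracontact K \<and> M \<in> K}"
    moreover have "{K\<^sub>1, K\<^sub>2} \<subseteq> {K. ultracontact K \<and> M \<in> K}" using uc M by simp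
    ultimately have "\<Sqinter>\<^bsub>UC\<^esub> {K\<^sub>1, K\<^sub>2} \<in> {K. ultracontact K \<and> M \<in> K}"
      by (simp add: closed_under_infima_def)
    \<comment> \<open>The binary meet is by definition the infimum of the pair, so the non-empty
      family of these two ultracontacts refutes closure.\<close>
    with not_meet show False by (simp add: meet_def)
  qed
  moreover have "M \<in> K\<^sub>1 \<inter> K\<^sub>2" using M by simp
  ultimately show ?thesis using uc not_meet by metis
qed

end
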